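(* Let $\mathfrak{g}=gl(n)$, let $V=\mathbb{C}^n$ be its standard representation, let $k$ be a positive integer, and let $\vec p=(p_1,\dots,p_k)\in\mathbb{C}^k$ with $p_1,\dots,p_k$ distinct. Let $\Phi:\mathbb{C}[\Sigma_k]\to\mathrm{End}_{\mathfrak{g}}(V^{\otimes k})$ be the algebra homomorphism given by permuting the tensor factors, which is taken to be an algebra isomorphism (Schur–Weyl duality), and let $$\Xi:[U(\mathfrak{g}[t])]^{\mathfrak{g}}\twoheadrightarrow\mathbb{C}[\Sigma_k],\qquad \Xi=\Phi^{-1}\circ\varphi^o,$$ be the resulting surjective algebra homomorphism, where $\varphi^o:[U(\mathfrak{g}[t])]^{\mathfrak{g}}\twoheadrightarrow\mathrm{End}_{\mathfrak{g}}(V^{\otimes k})$ is the surjective algebra homomorphism given by the action on the evaluation module $V^{\otimes k}$ at $\vec p$. For any reflection $\tau=(r,s)\in\Sigma_k$, define the polynomials $$P_\tau=(t-p_r+1)\cdot\prod_{d\ne r}\frac{(t-p_d)}{(p_r-p_d)},\qquad Q_\tau=(t-p_s+1)\cdot\prod_{d\ne s}\frac{(t-p_d)}{(p_s-p_d)}.$$ Then $$\Xi\Big(\sum_{1\le i,j\le n}E_{i,j}(P_\tau)\cdot E_{j,i}(Q_\tau)\Big)=\tau.$$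
   Context: $\mathfrak{g}[t]=\mathfrak{g}\otimes\mathbb{C}[t]$ is the Lie algebra with bracket $[x(P),y(Q)]=[x,y](PQ)$, where $x(P):=x\otimes P$ for $x\in\mathfrak{g}$, $P\in\mathbb{C}[t]$; $\mathfrak{g}$ is identified with $\mathfrak{g}\otimes 1$. $U(\mathfrak{g}[t])$ is its enveloping algebra and $[U(\mathfrak{g}[t])]^{\mathfrak{g}}$ is the subalgebra of $\mathfrak{g}$-invariants under the adjoint action. $E_{i,j}$ is the $n\times n$ matrix with $(i,j)$ entry $1$ and all other entries $0$. $\Sigma_k$ is the symmetric group, a reflection $(r,s)$ is the transposition of $r\neq s$, and $d$ in the products ranges over $\{1,\dots,k\}$. $\mathrm{End}_{\mathfrak{g}}(V^{\otimes k})$ is the algebra of $\mathfrak{g}$-module endomorphisms of $V^{\otimes k}$. The evaluation module structure on $V^{\otimes k}$ at $\vec p$ is $$x(P)\cdot(v_1\otimes\cdots\otimes v_k)=\sum_{i=1}^kP(p_i)\,v_1\otimes\cdots\otimes x\cdot v_i\otimes\cdots\otimes v_k ;$$ since the $p_i$ are distinct it is an irreducible $\mathfrak{g}[t]$-module, so $U(\mathfrak{g}[t])\to\mathrm{End}_{\mathbb{C}}(V^{\otimes k})$ is surjective, and taking $\mathfrak{g}$-invariants gives the surjection $\varphi^o$. *)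

theory Defs
  imports
    "HOL-Analysis.Analysis"
    "HOL-Library.Poly_Mapping"
    "HOL-Combinatorics.Perm"
    "HOL-Computational_Algebra.Polynomial"
begin

section \<open>Monoid algebras\<close>

text \<open>
  \<^typ>\<open>'m \<Rightarrow>\<^sub>0 complex\<close> carries the convolution product of the library as soon as \<^typ>\<open>'m\<close> is an
  \<^emph>\<open>additive\<close> monoid. The two wrappers below turn the free monoid of lists and a multiplicative
  monoid into (non-commutative) additive monoids, so that free algebras and group algebras are
  instances of that product.
\<close>

datatype 'a word = Word (letters: "'a list")

instantiation word :: (type) monoid_add
begin
definition "0 = Word []"
definition "v + w = Word (letters v @ letters w)"
instance by standard (simp_all add: zero_word_def plus_word_def)
end

datatype 'm as_add = Add (of_add: 'm)

instantiation as_add :: (monoid_mult) monoid_add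
begin
definition "0 = Add 1"
definition "a + b = Add (of_add a * of_add b)"
instance by standard (simp_all add: zero_as_add_def plus_as_add_def mult.assoc)
end

type_synonym 'a free_algebra = "'a word \<Rightarrow>\<^sub>0 complex"
type_synonym 'k group_algebra = "'k perm as_add \<Rightarrow>\<^sub>0 complex"

definition group_elem :: "'k perm \<Rightarrow> 'k group_algebra" where
  "group_elem \<sigma> = Poly_Mapping.single (Add \<sigma>) 1"

lemma poly_mapping_add_induct [case_names zero add single]:
  assumes "P 0" and "\<And>a b. P a \<Longrightarrow> P b \<Longrightarrow> P (a + b)" and "\<And>m c. P (Poly_Mapping.single m c)"
  shows "P (a :: 'm \<Rightarrow>\<^sub>0 'b::comm_monoid_add)"
proof (induction a rule: update_induct)
  case const
  show ?case by (rule assms(1))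
next
  case (update f m c)
  have "Poly_Mapping.update m c f = f + Poly_Mapping.single m c"
    using update(1)
    by (intro poly_mapping_eqI)
      (auto simp: lookup_update lookup_add lookup_single when_def in_keys_iff)
  then show ?case using assms update by simp
qed

text \<open>Linear extension of a family \<open>h\<close> of operators indexed by the basis of a monoid algebra.\<close>

definition alg_ext ::
  "('m \<Rightarrow> complex^'i \<Rightarrow> complex^'i) \<Rightarrow> ('m \<Rightarrow>\<^sub>0 complex) \<Rightarrow> complex^'i \<Rightarrow> complex^'i" where
  "alg_ext h a v = (\<Sum>m\<in>Poly_Mapping.keys a. Poly_Mapping.lookup a m *s h m v)"

lemma alg_ext_superset:
  assumes "finite S" "Poly_Mapping.keys a \<subseteq> S"
  shows "alg_ext h a v = (\<Sum>m\<in>S. Poly_Mapping.lookup a m *s h m v)"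
  unfolding alg_ext_def using assms
  by (intro sum.mono_neutral_left) (auto simp: in_keys_iff)

lemma alg_ext_zero [simp]: "alg_ext h 0 v = 0"
  by (simp add: alg_ext_def)

lemma alg_ext_single [simp]: "alg_ext h (Poly_Mapping.single m c) v = c *s h m v"
  by (simp add: alg_ext_def)

lemma alg_ext_add: "alg_ext h (a + b) v = alg_ext h a v + alg_ext h b v"
proof -
  let ?S = "Poly_Mapping.keys a \<union> Poly_Mapping.keys b"
  have "Poly_Mapping.keys (a + b) \<subseteq> ?S" by (rule keys_add)
  then show ?thesis
    by (simp add: alg_ext_superset[of ?S] lookup_add vec.scale_left_distrib sum.distrib)
qed

lemma alg_ext_minus: "alg_ext h (a - b) v = alg_ext h a v - alg_ext h b v"
proof -
  have "alg_ext h ((a - b) + b) v = alg_ext h (a - b) v + alg_ext h b v"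
    by (rule alg_ext_add)
  then show ?thesis by simp
qed

lemma vec_linearI:
  fixes f :: "complex^'i \<Rightarrow> complex^'j"
  assumes "\<And>u v. f (u + v) = f u + f v" and "\<And>c v. f (c *s v) = c *s f v"
  shows "Vector_Spaces.linear (*s) (*s) f"
  using assms by (simp add: Vector_Spaces.linear_iff vec.vector_space_axioms)

lemma alg_ext_linear:
  assumes "\<And>m. Vector_Spaces.linear (*s) (*s) (h m)"
  shows "Vector_Spaces.linear (*s) (*s) (alg_ext h a)"
proof (intro vec_linearI)
  fix u v
  show "alg_ext h a (u + v) = alg_ext h a u + alg_ext h a v"
    by (simp add: alg_ext_def vec.linear_add[OF assms] vec.scale_right_distrib sum.distrib)
next
  fix c v
  show "alg_ext h a (c *s v) = c *s alg_ext h a v"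
    by (simp add: alg_ext_def vec.linear_scale[OF assms] vec.scale_sum_right mult.commute)
qed

lemma alg_ext_one:
  assumes "h 0 = id"
  shows "alg_ext h 1 v = v"
  by (simp add: assms flip: single_one)

lemma alg_ext_mult:
  assumes lin: "\<And>m. Vector_Spaces.linear (*s) (*s) (h m)"
    and hom: "\<And>m m'. h (m + m') = h m \<circ> h m'"
  shows "alg_ext h (a * b) v = alg_ext h a (alg_ext h b v)"
proof (induction a rule: poly_mapping_add_induct)
  case (single m c)
  show ?case
  proof (induction b rule: poly_mapping_add_induct)
    case zero
    then show ?case by (simp add: vec.linear_0[OF lin])
  next
    case (add a b)
    then show ?case
      by (simp add: distrib_left alg_ext_add vec.linear_add[OF lin] vec.scale_right_distrib)
  next
    case (single m' c')
    then show ?case by (simp add: mult_single hom vec.linear_scale[OF lin])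
  qed
qed (simp_all add: distrib_right alg_ext_add)


section \<open>Complex Lie algebras and their enveloping algebras\<close>

class complex_lie_algebra = ab_group_add +
  fixes lie_scale :: "complex \<Rightarrow> 'a \<Rightarrow> 'a"
    and lie_bracket :: "'a \<Rightarrow> 'a \<Rightarrow> 'a"
  assumes lie_scale_add_right: "lie_scale c (x + y) = lie_scale c x + lie_scale c y"
    and lie_scale_add_left: "lie_scale (c + d) x = lie_scale c x + lie_scale d x"
    and lie_scale_scale: "lie_scale c (lie_scale d x) = lie_scale (c * d) x"
    and lie_scale_one: "lie_scale 1 x = x"
    and bracket_add_left: "lie_bracket (x + y) z = lie_bracket x z + lie_bracket y z"
    and bracket_add_right: "lie_bracket x (y + z) = lie_bracket x y + lie_bracket x z"
    and bracket_scale_left: "lie_bracket (lie_scale c x) y = lie_scale c (lie_bracket x y)"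
    and bracket_scale_right: "lie_bracket x (lie_scale c y) = lie_scale c (lie_bracket x y)"
    and bracket_self: "lie_bracket x x = 0"
    and jacobi: "lie_bracket x (lie_bracket y z) + lie_bracket y (lie_bracket z x)
      + lie_bracket z (lie_bracket x y) = 0"

definition gen :: "'a \<Rightarrow> 'a free_algebra" where
  "gen x = Poly_Mapping.single (Word [x]) 1"

text \<open>
  The free algebra here is the one on the underlying \<^emph>\<open>set\<close> of the Lie algebra; the first two
  rules divide out linearity of \<^const>\<open>gen\<close> (giving the tensor algebra), the third one the
  commutator relation.
\<close>

inductive_set uea_ideal :: "'a::complex_lie_algebra free_algebra set" where
  rel_add: "gen (x + y) - gen x - gen y \<in> uea_ideal"
| rel_scale: "gen (lie_scale c x) - Poly_Mapping.single 0 c * gen x \<in> uea_ideal"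
| rel_bracket: "gen x * gen y - gen y * gen x - gen (lie_bracket x y) \<in> uea_ideal"
| zero: "0 \<in> uea_ideal"
| add: "a \<in> uea_ideal \<Longrightarrow> b \<in> uea_ideal \<Longrightarrow> a + b \<in> uea_ideal"
| mult: "a \<in> uea_ideal \<Longrightarrow> l * a * r \<in> uea_ideal"

lemma uea_ideal_mult_left: "a \<in> uea_ideal \<Longrightarrow> l * a \<in> uea_ideal"
  using uea_ideal.mult[of a l 1] by simp

lemma uea_ideal_mult_right: "a \<in> uea_ideal \<Longrightarrow> a * r \<in> uea_ideal"
  using uea_ideal.mult[of a 1 r] by simp

lemma uea_ideal_uminus: "a \<in> uea_ideal \<Longrightarrow> - a \<in> uea_ideal"
  using uea_ideal_mult_left[of a "- 1"] by simp

lemma uea_ideal_kernel: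
  assumes lin: "\<And>w. Vector_Spaces.linear (*s) (*s) (h w)"
    and hom: "\<And>w w'. h (w + w') = h w \<circ> h w'" and one: "h 0 = id"
    and h_add: "\<And>x y v. h (Word [x + y]) v = h (Word [x]) v + h (Word [y]) v"
    and h_scale: "\<And>c x v. h (Word [lie_scale c x]) v = c *s h (Word [x]) v"
    and h_bracket: "\<And>x y v. h (Word [lie_bracket x y]) v
      = h (Word [x]) (h (Word [y]) v) - h (Word [y]) (h (Word [x]) v)"
    and "a \<in> uea_ideal"
  shows "alg_ext h a v = 0"
  using \<open>a \<in> uea_ideal\<close>
proof (induction arbitrary: v)
  case (mult a l r)
  then show ?case
    by (simp add: alg_ext_mult[OF lin hom] vec.linear_0[OF alg_ext_linear[OF lin]])
qed (simp_all add: alg_ext_minus alg_ext_add alg_ext_mult[OF lin hom] gen_def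
      h_add h_scale h_bracket one)

lemma one_notin_uea_ideal: "1 \<notin> uea_ideal"
proof
  assume *: "(1 :: 'a free_algebra) \<in> uea_ideal"
  define h :: "'a word \<Rightarrow> complex^1 \<Rightarrow> complex^1" where "h w v = (if w = 0 then v else 0)" for w v
  have "alg_ext h 1 1 = 0"
  proof (rule uea_ideal_kernel[OF _ _ _ _ _ _ *])
    fix w show "Vector_Spaces.linear (*s) (*s) (h w)"
      by (intro vec_linearI) (auto simp: h_def)
  next
    have "v + w = 0 \<longleftrightarrow> v = 0 \<and> w = 0" for v w :: "'a word"
      by (cases v; cases w) (auto simp: zero_word_def plus_word_def)
    then show "h (w + w') = h w \<circ> h w'" for w w'
      by (auto simp: h_def fun_eq_iff)
  qed (auto simp: h_def zero_word_def)
  moreover have "alg_ext h 1 1 = 1"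
    by (rule alg_ext_one) (auto simp: h_def)
  ultimately show False by simp
qed

quotient_type (overloaded) 'a uea = "'a::complex_lie_algebra free_algebra"
  / "\<lambda>a b. a - b \<in> uea_ideal"
proof (rule equivpI)
  show "reflp (\<lambda>a b :: 'a free_algebra. a - b \<in> uea_ideal)"
    by (simp add: reflp_def uea_ideal.zero)
  show "symp (\<lambda>a b :: 'a free_algebra. a - b \<in> uea_ideal)"
    using uea_ideal_uminus by (force simp: symp_def)
  show "transp (\<lambda>a b :: 'a free_algebra. a - b \<in> uea_ideal)"
  proof (rule transpI)
    fix a b c :: "'a free_algebra"
    assume "a - b \<in> uea_ideal" "b - c \<in> uea_ideal"
    then have "(a - b) + (b - c) \<in> uea_ideal" by (rule uea_ideal.add)
    then show "a - c \<in> uea_ideal" by simp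
  qed
qed

instantiation uea :: (complex_lie_algebra) ring_1
begin

lift_definition zero_uea :: "'a uea" is 0 .
lift_definition one_uea :: "'a uea" is 1 .

lift_definition plus_uea :: "'a uea \<Rightarrow> 'a uea \<Rightarrow> 'a uea" is "(+)"
proof -
  fix a a' b b' :: "'a free_algebra"
  assume "a - a' \<in> uea_ideal" "b - b' \<in> uea_ideal"
  then have "(a - a') + (b - b') \<in> uea_ideal" by (rule uea_ideal.add)
  then show "a + b - (a' + b') \<in> uea_ideal" by (simp add: algebra_simps)
qed

lift_definition uminus_uea :: "'a uea \<Rightarrow> 'a uea" is uminus
  using uea_ideal_uminus by force

lift_definition minus_uea :: "'a uea \<Rightarrow> 'a uea \<Rightarrow> 'a uea" is "(-)"
proof -
  fix a a' b b' :: "'a free_algebra"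
  assume "a - a' \<in> uea_ideal" "b - b' \<in> uea_ideal"
  then have "(a - a') + - (b - b') \<in> uea_ideal"
    by (intro uea_ideal.add uea_ideal_uminus)
  then show "a - b - (a' - b') \<in> uea_ideal" by (simp add: algebra_simps)
qed

lift_definition times_uea :: "'a uea \<Rightarrow> 'a uea \<Rightarrow> 'a uea" is "(*)"
proof -
  fix a a' b b' :: "'a free_algebra"
  assume "a - a' \<in> uea_ideal" "b - b' \<in> uea_ideal"
  then have "(a - a') * b + a' * (b - b') \<in> uea_ideal"
    by (intro uea_ideal.add uea_ideal_mult_left uea_ideal_mult_right)
  then show "a * b - a' * b' \<in> uea_ideal" by (simp add: algebra_simps)
qed

instance
proof
  show "(0 :: 'a uea) \<noteq> 1"
    by transfer (use one_notin_uea_ideal uea_ideal_uminus in force)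
qed (transfer; simp add: algebra_simps uea_ideal.zero)+

end

lift_definition \<iota> :: "'a::complex_lie_algebra \<Rightarrow> 'a uea" is gen .

lemma \<iota>_add: "\<iota> (x + y) = \<iota> x + \<iota> y"
  by transfer (use uea_ideal.rel_add in \<open>simp add: algebra_simps\<close>)

lemma \<iota>_bracket: "\<iota> (lie_bracket x y) = \<iota> x * \<iota> y - \<iota> y * \<iota> x"
proof transfer
  fix x y :: 'a
  show "gen (lie_bracket x y) - (gen x * gen y - gen y * gen x) \<in> uea_ideal"
    using uea_ideal_uminus[OF uea_ideal.rel_bracket[of x y]] by simp
qed


lemma smult_sum_right: "smult c (\<Sum>i\<in>I. f i) = (\<Sum>i\<in>I. smult c (f i))"
  by (induction I rule: infinite_finite_induct) (simp_all add: smult_add_right)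


section \<open>The current algebra of the general linear Lie algebra\<close>

text \<open>
  \<open>gl(n)\<close> is \<^typ>\<open>complex^'n^'n\<close>, and its tensor product with the polynomial ring is realised
  as the matrices with polynomial entries, \<open>x \<otimes> P\<close> being the matrix with entries \<open>x\<^sub>i\<^sub>j P\<close>.
\<close>

typedef ('n::finite) gl_current = "UNIV :: (complex poly ^ 'n ^ 'n) set"
  morphisms entries of_entries ..

setup_lifting type_definition_gl_current

instantiation gl_current :: (finite) complex_lie_algebra
begin

lift_definition zero_gl_current :: "'a gl_current" is 0 .
lift_definition plus_gl_current :: "'a gl_current \<Rightarrow> 'a gl_current \<Rightarrow> 'a gl_current" is "(+)" .
lift_definition uminus_gl_current :: "'a gl_current \<Rightarrow> 'a gl_current" is uminus .
lift_definition minus_gl_current :: "'a gl_current \<Rightarrow> 'a gl_current \<Rightarrow> 'a gl_current" is "(-)" .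

lift_definition lie_scale_gl_current :: "complex \<Rightarrow> 'a gl_current \<Rightarrow> 'a gl_current"
  is "\<lambda>c A. \<chi> i j. smult c (A $ i $ j)" .

lift_definition lie_bracket_gl_current :: "'a gl_current \<Rightarrow> 'a gl_current \<Rightarrow> 'a gl_current"
  is "\<lambda>A B. A ** B - B ** A" .

instance
proof (standard; transfer)
  fix A B C :: "complex poly ^ 'a ^ 'a"
  have ldiff: "A ** (B - C) = A ** B - A ** C" for A B C :: "complex poly ^ 'a ^ 'a"
    by (simp add: vec_eq_iff matrix_matrix_mult_def right_diff_distrib sum_subtractf)
  have rdiff: "(A - B) ** C = A ** C - B ** C" for A B C :: "complex poly ^ 'a ^ 'a"
    by (simp add: vec_eq_iff matrix_matrix_mult_def left_diff_distrib sum_subtractf)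
  show "A ** (B ** C - C ** B) - (B ** C - C ** B) ** A
      + (B ** (C ** A - A ** C) - (C ** A - A ** C) ** B)
      + (C ** (A ** B - B ** A) - (A ** B - B ** A) ** C) = 0"
    by (simp add: ldiff rdiff matrix_mul_assoc)
qed (simp_all add: vec_eq_iff matrix_matrix_mult_def smult_add_right smult_add_left
      smult_diff_right smult_sum_right algebra_simps sum.distrib)

end

lift_definition tensor_poly :: "complex^'n^'n \<Rightarrow> complex poly \<Rightarrow> 'n::finite gl_current"
  (infix \<open>\<otimes>\<^sub>t\<close> 75)
  is "\<lambda>x P. \<chi> i j. smult (x $ i $ j) P" .

definition matrix_unit :: "'n \<Rightarrow> 'n \<Rightarrow> complex^'n^'n" where
  "matrix_unit i j = (\<chi> a b. if a = i \<and> b = j then 1 else 0)"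

lemma bracket_tensor_poly:
  "lie_bracket (x \<otimes>\<^sub>t P) (y \<otimes>\<^sub>t Q) = (x ** y - y ** x) \<otimes>\<^sub>t (P * Q)"
  by transfer
    (simp add: vec_eq_iff matrix_matrix_mult_def smult_diff_left smult_sum mult.commute)

lemma entries_sum: "entries (\<Sum>i\<in>I. A i) = (\<Sum>i\<in>I. entries (A i))"
  by (induction I rule: infinite_finite_induct)
    (simp_all add: zero_gl_current.rep_eq plus_gl_current.rep_eq)

lemma gl_current_decompose:
  "A = (\<Sum>i\<in>UNIV. \<Sum>j\<in>UNIV. matrix_unit i j \<otimes>\<^sub>t (entries A $ i $ j))"
proof -
  have "(\<Sum>i\<in>UNIV. \<Sum>j\<in>UNIV. smult (if a = i \<and> b = j then 1 else 0) (entries A $ i $ j))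
      = entries A $ a $ b" for a b
  proof -
    have "(\<Sum>i\<in>UNIV. \<Sum>j\<in>UNIV. smult (if a = i \<and> b = j then 1 else 0) (entries A $ i $ j))
      = (\<Sum>i\<in>UNIV. \<Sum>j\<in>UNIV. if j = b then if i = a then entries A $ a $ b else 0 else 0)"
      by (intro sum.cong) auto
    then show ?thesis by simp
  qed
  then show ?thesis
    by (simp add: entries_inject [symmetric] vec_eq_iff entries_sum tensor_poly.rep_eq
        matrix_unit_def)
qed

text \<open>
  \<^const>\<open>tensor_poly\<close> has the universal property of the tensor product of \<open>gl(n)\<close> and \<open>\<complex>[t]\<close>.
\<close>

lemma tensor_poly_universal:
  fixes \<beta> :: "complex^'n^'n \<Rightarrow> complex poly \<Rightarrow> 'w::ab_group_add"
    and sc :: "complex \<Rightarrow> 'w \<Rightarrow> 'w"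
  assumes "\<And>x y P. \<beta> (x + y) P = \<beta> x P + \<beta> y P"
    and "\<And>x P Q. \<beta> x (P + Q) = \<beta> x P + \<beta> x Q"
    and "\<And>c x P. \<beta> (\<chi> i j. c * x $ i $ j) P = sc c (\<beta> x P)"
    and "\<And>c x P. \<beta> x (smult c P) = sc c (\<beta> x P)"
    and "vector_space sc"
  shows "\<exists>!f. (\<forall>A B. f (A + B) = f A + f B) \<and> (\<forall>c A. f (lie_scale c A) = sc c (f A))
    \<and> (\<forall>x P. f (x \<otimes>\<^sub>t P) = \<beta> x P)"
proof (rule ex_ex1I)
  interpret vector_space sc by fact
  define f where "f A = (\<Sum>i\<in>UNIV. \<Sum>j\<in>UNIV. \<beta> (matrix_unit i j) (entries A $ i $ j))" for A
  have \<beta>0: "\<beta> 0 P = 0" for P using assms(1)[of 0 0 P] by simp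
  have \<beta>sum: "\<beta> (\<Sum>i\<in>I. x i) P = (\<Sum>i\<in>I. \<beta> (x i) P)" for I P and x :: "'n \<Rightarrow> _"
    by (induction I rule: infinite_finite_induct) (simp_all add: assms(1) \<beta>0)
  have "f (x \<otimes>\<^sub>t P) = \<beta> x P" for x P
  proof -
    have "f (x \<otimes>\<^sub>t P)
        = \<beta> (\<Sum>i\<in>UNIV. \<Sum>j\<in>UNIV. \<chi> a b. x $ i $ j * matrix_unit i j $ a $ b) P"
      by (simp add: f_def tensor_poly.rep_eq assms(3,4) \<beta>sum)
    also have "(\<Sum>i\<in>UNIV. \<Sum>j\<in>UNIV. \<chi> a b. x $ i $ j * matrix_unit i j $ a $ b) = x"
    proof -
      have "(\<Sum>i\<in>UNIV. \<Sum>j\<in>UNIV. x $ i $ j * (if a = i \<and> b = j then 1 else 0))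
        = (\<Sum>i\<in>UNIV. \<Sum>j\<in>UNIV. if j = b then if i = a then x $ a $ b else 0 else 0)" for a b
        by (intro sum.cong) auto
      then show ?thesis by (simp add: vec_eq_iff matrix_unit_def)
    qed
    finally show ?thesis .
  qed
  moreover have "f (A + B) = f A + f B" for A B
    by (simp add: f_def plus_gl_current.rep_eq assms(2) sum.distrib)
  moreover have "f (lie_scale c A) = sc c (f A)" for c A
    by (simp add: f_def lie_scale_gl_current.rep_eq assms(4) scale_sum_right)
  ultimately show "\<exists>f. (\<forall>A B. f (A + B) = f A + f B) \<and> (\<forall>c A. f (lie_scale c A) = sc c (f A))
    \<and> (\<forall>x P. f (x \<otimes>\<^sub>t P) = \<beta> x P)"
    by blast
next
  fix f g :: "'n gl_current \<Rightarrow> 'w"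
  assume f: "(\<forall>A B. f (A + B) = f A + f B) \<and> (\<forall>c A. f (lie_scale c A) = sc c (f A))
      \<and> (\<forall>x P. f (x \<otimes>\<^sub>t P) = \<beta> x P)"
    and g: "(\<forall>A B. g (A + B) = g A + g B) \<and> (\<forall>c A. g (lie_scale c A) = sc c (g A))
      \<and> (\<forall>x P. g (x \<otimes>\<^sub>t P) = \<beta> x P)"
  have sum: "h (\<Sum>i\<in>I. A i) = (\<Sum>i\<in>I. h (A i))"
    if "\<forall>A B. h (A + B) = h A + h B"
    for h :: "'n gl_current \<Rightarrow> 'w" and I and A :: "'n \<Rightarrow> _"
  proof -
    have "h 0 = 0" using that[rule_format, of 0 0] by simp
    then show ?thesis
      by (induction I rule: infinite_finite_induct) (simp_all add: that)
  qed
  show "f = g"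
  proof
    fix A
    show "f A = g A"
      by (subst (1 2) gl_current_decompose) (simp add: f g sum)
  qed
qed


section \<open>Tensor powers of the standard representation\<close>

text \<open>
  The \<open>k\<close>-th tensor power of \<open>\<complex>\<^sup>n\<close> in coordinates: the basis vector indexed by \<open>f :: 'k \<Rightarrow> 'n\<close> is the
  pure tensor with factor \<open>e\<^bsub>f i\<^esub>\<close> at position \<open>i\<close>.
\<close>

type_synonym ('n, 'k) tensor_power = "complex ^ ('k \<Rightarrow> 'n)"

definition pure_tensor :: "('k::finite \<Rightarrow> complex^'n) \<Rightarrow> ('n::finite, 'k) tensor_power" where
  "pure_tensor v = (\<chi> f. \<Prod>i\<in>UNIV. v i $ f i)"

lemma pure_tensor_basis: "pure_tensor (\<lambda>i. axis (f i) 1) = axis f 1"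
proof -
  have "(\<Prod>i\<in>UNIV. axis (f i) (1::complex) $ g i) = axis f 1 $ g" for g
  proof (cases "g = f")
    case False
    then obtain i where "g i \<noteq> f i" by auto
    then have "(\<Prod>i\<in>UNIV. axis (f i) (1::complex) $ g i) = 0"
      by (intro prod_zero bexI[of _ i]) (auto simp: axis_def)
    with False show ?thesis by (simp add: axis_def)
  qed (simp add: axis_def)
  then show ?thesis by (simp add: pure_tensor_def vec_eq_iff)
qed

text \<open>The operator applying \<open>x\<close> to the \<open>i\<close>-th tensor factor.\<close>

definition site_act ::
  "'k::finite \<Rightarrow> complex^'n^'n \<Rightarrow> ('n::finite, 'k) tensor_power \<Rightarrow> ('n, 'k) tensor_power" where
  "site_act i x T = (\<chi> f. \<Sum>a\<in>UNIV. x $ f i $ a * T $ f(i := a))"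

lemma site_act_pure: "site_act i x (pure_tensor v) = pure_tensor (v(i := x *v v i))"
proof -
  have "(\<Sum>a\<in>UNIV. x $ f i $ a * (\<Prod>j\<in>UNIV. v j $ (f(i := a)) j))
      = (\<Prod>j\<in>UNIV. (v(i := x *v v i)) j $ f j)" for f
    by (simp add: prod.remove[of UNIV i] matrix_vector_mult_def sum_distrib_right mult.assoc)
  then show ?thesis by (simp add: site_act_def pure_tensor_def vec_eq_iff)
qed

lemma site_act_linear: "Vector_Spaces.linear (*s) (*s) (site_act i x)"
  by (intro vec_linearI)
    (simp_all add: site_act_def vec_eq_iff sum.distrib sum_distrib_left algebra_simps)

lemma site_act_add: "site_act i (x + y) T = site_act i x T + site_act i y T"
  by (simp add: site_act_def vec_eq_iff sum.distrib algebra_simps)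

lemma site_act_diff: "site_act i (x - y) T = site_act i x T - site_act i y T"
  by (simp add: site_act_def vec_eq_iff sum_subtractf algebra_simps)

lemma site_act_same: "site_act i x (site_act i y T) = site_act i (x ** y) T"
proof -
  have "(\<Sum>a\<in>UNIV. x $ f i $ a * (\<Sum>b\<in>UNIV. y $ a $ b * T $ f(i := b)))
      = (\<Sum>b\<in>UNIV. (\<Sum>a\<in>UNIV. x $ f i $ a * y $ a $ b) * T $ f(i := b))" for f
    unfolding sum_distrib_left sum_distrib_right
    by (subst sum.swap) (simp add: mult.assoc)
  then show ?thesis by (simp add: site_act_def vec_eq_iff matrix_matrix_mult_def)
qed

lemma site_act_commute:
  assumes "i \<noteq> j"
  shows "site_act i x (site_act j y T) = site_act j y (site_act i x T)"
proof -
  have "(\<Sum>a\<in>UNIV. x $ f i $ a * (\<Sum>b\<in>UNIV. y $ f j $ b * T $ f(i := a, j := b)))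
      = (\<Sum>b\<in>UNIV. y $ f j $ b * (\<Sum>a\<in>UNIV. x $ f i $ a * T $ f(j := b, i := a)))" for f
    unfolding sum_distrib_left
    by (subst sum.swap) (simp add: fun_upd_twist[OF assms] mult.left_commute)
  then show ?thesis using assms by (simp add: site_act_def vec_eq_iff)
qed

definition gl_act ::
  "complex^'n^'n \<Rightarrow> ('n::finite, 'k::finite) tensor_power \<Rightarrow> ('n, 'k) tensor_power" where
  "gl_act x T = (\<Sum>i\<in>UNIV. site_act i x T)"

definition End_gl :: "(('n::finite, 'k::finite) tensor_power \<Rightarrow> ('n, 'k) tensor_power) set" where
  "End_gl = {F. Vector_Spaces.linear (*s) (*s) F \<and> (\<forall>x T. F (gl_act x T) = gl_act x (F T))}"


section \<open>Permutation of the tensor factors\<close>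

text \<open>The factor at position \<open>i\<close> is moved to position \<open>\<sigma> i\<close>; this is a left action.\<close>

definition perm_act ::
  "'k perm \<Rightarrow> ('n::finite, 'k::finite) tensor_power \<Rightarrow> ('n, 'k) tensor_power" where
  "perm_act \<sigma> T = (\<chi> f. T $ (f \<circ> perm.apply \<sigma>))"

lemma perm_act_pure: "perm_act \<sigma> (pure_tensor v) = pure_tensor (v \<circ> perm.apply (inverse \<sigma>))"
proof -
  have "(\<Prod>i\<in>UNIV. v i $ f (perm.apply \<sigma> i))
      = (\<Prod>i\<in>UNIV. v (perm.apply (inverse \<sigma>) i) $ f i)" for f
    by (rule prod.reindex_bij_witness[where i = "perm.apply (inverse \<sigma>)" and j = "perm.apply \<sigma>"])
      (simp_all add: Perm.apply_sequence)
  then show ?thesis by (simp add: perm_act_def pure_tensor_def vec_eq_iff)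
qed

lemma perm_act_linear: "Vector_Spaces.linear (*s) (*s) (perm_act \<sigma>)"
  by (intro vec_linearI) (simp_all add: perm_act_def vec_eq_iff)

lemma perm_act_one: "perm_act 1 = id"
  by (simp add: perm_act_def fun_eq_iff vec_eq_iff)

lemma perm_act_mult: "perm_act (\<sigma> * \<tau>) = perm_act \<sigma> \<circ> perm_act \<tau>"
  by (simp add: perm_act_def fun_eq_iff vec_eq_iff Perm.apply_times comp_assoc)

lemma perm_act_site_act:
  fixes T :: "('n::finite, 'k::finite) tensor_power"
  shows "perm_act \<sigma> (site_act i x T) = site_act (perm.apply \<sigma> i) x (perm_act \<sigma> T)"
proof -
  have "(f \<circ> perm.apply \<sigma>)(i := a) = f(perm.apply \<sigma> i := a) \<circ> perm.apply \<sigma>" for f :: "'k \<Rightarrow> 'n" and a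
    by (auto simp: fun_eq_iff Perm.apply_inj)
  then show ?thesis by (simp add: perm_act_def site_act_def vec_eq_iff)
qed

lemma perm_act_gl_act: "perm_act \<sigma> (gl_act x T) = gl_act x (perm_act \<sigma> T)"
proof -
  have "perm_act \<sigma> (gl_act x T) = (\<Sum>i\<in>UNIV. site_act (perm.apply \<sigma> i) x (perm_act \<sigma> T))"
    by (simp add: gl_act_def vec.linear_sum[OF perm_act_linear] perm_act_site_act)
  also have "\<dots> = gl_act x (perm_act \<sigma> T)"
    unfolding gl_act_def by (rule sum.reindex_bij_betw) (simp add: Perm.bij_apply)
  finally show ?thesis .
qed

definition \<Phi> ::
  "'k::finite group_algebra \<Rightarrow> ('n::finite, 'k) tensor_power \<Rightarrow> ('n, 'k) tensor_power" where
  "\<Phi> = alg_ext (\<lambda>m. perm_act (of_add m))"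

lemma \<Phi>_group_elem: "\<Phi> (group_elem \<sigma>) = perm_act \<sigma>"
  by (simp add: \<Phi>_def group_elem_def fun_eq_iff)

lemma \<Phi>_one: "\<Phi> 1 = id"
  by (simp add: \<Phi>_def fun_eq_iff alg_ext_one perm_act_one zero_as_add_def)

lemma \<Phi>_mult: "\<Phi> (a * b) = \<Phi> a \<circ> \<Phi> b"
  by (simp add: \<Phi>_def fun_eq_iff alg_ext_mult perm_act_linear perm_act_mult plus_as_add_def)

lemma \<Phi>_in_End_gl:
  "(\<Phi> a :: ('n::finite, 'k::finite) tensor_power \<Rightarrow> ('n, 'k) tensor_power) \<in> End_gl"
proof -
  have "\<Phi> a (gl_act x T) = gl_act x (\<Phi> a T)" for x and T :: "('n, 'k) tensor_power"
  proof -
    have "Vector_Spaces.linear (*s) (*s) (gl_act x :: ('n, 'k) tensor_power \<Rightarrow> _)"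
      by (intro vec_linearI)
        (simp_all add: gl_act_def sum.distrib vec.scale_sum_right
          vec.linear_add[OF site_act_linear] vec.linear_scale[OF site_act_linear])
    note lin = vec.linear_sum[OF this] vec.linear_scale[OF this]
    show ?thesis by (simp add: \<Phi>_def alg_ext_def lin perm_act_gl_act)
  qed
  moreover have "Vector_Spaces.linear (*s) (*s) (\<Phi> a :: ('n, 'k) tensor_power \<Rightarrow> _)"
    by (simp add: \<Phi>_def alg_ext_linear perm_act_linear)
  ultimately show ?thesis by (simp add: End_gl_def)
qed


section \<open>The evaluation module\<close>

definition eval_at :: "'n::finite gl_current \<Rightarrow> complex \<Rightarrow> complex^'n^'n" where
  "eval_at A z = (\<chi> a b. poly (entries A $ a $ b) z)"

definition current_act ::
  "complex^'k \<Rightarrow> 'n gl_current \<Rightarrow> ('n::finite, 'k::finite) tensor_power \<Rightarrow> ('n, 'k) tensor_power"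
where
  "current_act p A T = (\<Sum>i\<in>UNIV. site_act i (eval_at A (p $ i)) T)"

lemma current_act_tensor_poly:
  fixes v :: "'k::finite \<Rightarrow> complex^'n::finite"
  shows "current_act p (x \<otimes>\<^sub>t P) (pure_tensor v)
    = (\<Sum>i\<in>UNIV. poly P (p $ i) *s pure_tensor (v(i := x *v v i)))"
proof -
  have "site_act i (eval_at (x \<otimes>\<^sub>t P) z) T = poly P z *s site_act i x T"
    for i z and T :: "('n, 'k) tensor_power"
    by (simp add: site_act_def eval_at_def tensor_poly.rep_eq vec_eq_iff sum_distrib_left
        algebra_simps)
  then show ?thesis by (simp add: current_act_def flip: site_act_pure)
qed

lemma current_act_constant: "current_act p (x \<otimes>\<^sub>t 1) = gl_act x"
proof -
  have "eval_at (x \<otimes>\<^sub>t 1) z = x" for z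
    by (simp add: eval_at_def tensor_poly.rep_eq vec_eq_iff)
  then show ?thesis by (simp add: fun_eq_iff current_act_def gl_act_def)
qed

lemma current_act_linear: "Vector_Spaces.linear (*s) (*s) (current_act p A)"
  by (intro vec_linearI)
    (simp_all add: current_act_def sum.distrib vec.scale_sum_right
      vec.linear_add[OF site_act_linear] vec.linear_scale[OF site_act_linear])

lemma current_act_add: "current_act p (A + B) T = current_act p A T + current_act p B T"
proof -
  have "eval_at (A + B) z = eval_at A z + eval_at B z" for z
    by (simp add: eval_at_def plus_gl_current.rep_eq vec_eq_iff)
  then show ?thesis by (simp add: current_act_def site_act_add sum.distrib)
qed

lemma current_act_scale: "current_act p (lie_scale c A) T = c *s current_act p A T"
proof -
  have "site_act i (eval_at (lie_scale c A) z) T = c *s site_act i (eval_at A z) T" for i z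
    by (simp add: site_act_def eval_at_def lie_scale_gl_current.rep_eq vec_eq_iff
        sum_distrib_left algebra_simps)
  then show ?thesis by (simp add: current_act_def vec.scale_sum_right)
qed

lemma current_act_bracket:
  "current_act p (lie_bracket A B) T
    = current_act p A (current_act p B T) - current_act p B (current_act p A T)"
proof -
  let ?a = "\<lambda>i. site_act i (eval_at A (p $ i))"
  let ?b = "\<lambda>i. site_act i (eval_at B (p $ i))"
  have ev: "eval_at (lie_bracket A B) z = eval_at A z ** eval_at B z - eval_at B z ** eval_at A z"
    for z
    by (simp add: eval_at_def lie_bracket_gl_current.rep_eq vec_eq_iff matrix_matrix_mult_def
        poly_sum)
  have "current_act p A (current_act p B T) - current_act p B (current_act p A T)
      = (\<Sum>i\<in>UNIV. \<Sum>j\<in>UNIV. ?a i (?b j T)) - (\<Sum>j\<in>UNIV. \<Sum>i\<in>UNIV. ?b j (?a i T))"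
    by (simp add: current_act_def vec.linear_sum[OF site_act_linear])
  also have "\<dots> = (\<Sum>i\<in>UNIV. \<Sum>j\<in>UNIV. ?a i (?b j T) - ?b j (?a i T))"
    by (subst (2) sum.swap) (simp add: sum_subtractf)
  also have "\<dots> = (\<Sum>i\<in>UNIV. \<Sum>j\<in>UNIV. if j = i then ?a i (?b i T) - ?b i (?a i T) else 0)"
    by (intro sum.cong) (auto simp: site_act_commute)
  also have "\<dots> = current_act p (lie_bracket A B) T"
    by (simp add: current_act_def ev site_act_diff site_act_same)
  finally show ?thesis by simp
qed

lemma foldr_current_act_linear:
  "Vector_Spaces.linear (*s) (*s) (foldr (current_act p) xs)"
proof (induction xs)
  case Nil
  show ?case by (intro vec_linearI) simp_all
next
  case (Cons A xs)
  then show ?case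
    by (intro vec_linearI)
      (simp_all add: vec.linear_add vec.linear_scale current_act_linear)
qed

lift_definition eval_rep ::
  "complex^'k \<Rightarrow> 'n gl_current uea
    \<Rightarrow> ('n::finite, 'k::finite) tensor_power \<Rightarrow> ('n, 'k) tensor_power"
  is "\<lambda>p. alg_ext (\<lambda>w. foldr (current_act p) (letters w))"
proof -
  fix p :: "complex^'k" and a b :: "'n gl_current free_algebra"
  let ?h = "\<lambda>w. foldr (current_act p) (letters w)"
  assume *: "a - b \<in> uea_ideal"
  have "alg_ext ?h (a - b) v = 0" for v
    by (rule uea_ideal_kernel[OF _ _ _ _ _ _ *])
      (simp_all add: foldr_current_act_linear plus_word_def zero_word_def fun_eq_iff
        current_act_add current_act_scale current_act_bracket)
  then show "alg_ext ?h a = alg_ext ?h b"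
    by (simp add: fun_eq_iff alg_ext_minus)
qed

lemma eval_rep_\<iota>: "eval_rep p (\<iota> A) = current_act p A"
  by transfer (simp add: fun_eq_iff gen_def)

lemma eval_rep_one: "eval_rep p 1 = id"
  by transfer (simp add: fun_eq_iff alg_ext_one zero_word_def)

lemma eval_rep_add: "eval_rep p (u + v) T = eval_rep p u T + eval_rep p v T"
  by transfer (simp add: alg_ext_add)

lemma eval_rep_minus: "eval_rep p (u - v) T = eval_rep p u T - eval_rep p v T"
  by transfer (simp add: alg_ext_minus)

lemma eval_rep_mult: "eval_rep p (u * v) = eval_rep p u \<circ> eval_rep p v"
  by transfer (simp add: fun_eq_iff alg_ext_mult foldr_current_act_linear plus_word_def)

lemma eval_rep_linear: "Vector_Spaces.linear (*s) (*s) (eval_rep p u)"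
  by transfer (simp add: alg_ext_linear foldr_current_act_linear)


section \<open>Invariants and the map to the group algebra\<close>

text \<open>The adjoint action of \<open>gl(n)\<close>, embedded in the current algebra as the constants \<open>x \<otimes> 1\<close>.\<close>

definition uea_ad :: "complex^'n^'n \<Rightarrow> 'n::finite gl_current uea \<Rightarrow> 'n gl_current uea" where
  "uea_ad x u = \<iota> (x \<otimes>\<^sub>t 1) * u - u * \<iota> (x \<otimes>\<^sub>t 1)"

definition uea_invariants :: "'n::finite gl_current uea set" where
  "uea_invariants = {u. \<forall>x. uea_ad x u = 0}"

definition \<phi>\<^sub>o ::
  "complex^'k \<Rightarrow> 'n gl_current uea
    \<Rightarrow> ('n::finite, 'k::finite) tensor_power \<Rightarrow> ('n, 'k) tensor_power" where
  "\<phi>\<^sub>o p = restrict (eval_rep p) uea_invariants"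

lemma \<phi>\<^sub>o_in_End_gl:
  assumes "u \<in> uea_invariants"
  shows "\<phi>\<^sub>o p u \<in> End_gl"
proof -
  have "eval_rep p u (gl_act x T) = gl_act x (eval_rep p u T)" for x T
  proof -
    have "\<iota> (x \<otimes>\<^sub>t 1) * u = u * \<iota> (x \<otimes>\<^sub>t 1)"
      using assms by (simp add: uea_invariants_def uea_ad_def)
    then have "eval_rep p (\<iota> (x \<otimes>\<^sub>t 1) * u) T = eval_rep p (u * \<iota> (x \<otimes>\<^sub>t 1)) T"
      by simp
    then show ?thesis by (simp add: eval_rep_mult eval_rep_\<iota> current_act_constant)
  qed
  then show ?thesis using assms by (simp add: \<phi>\<^sub>o_def End_gl_def eval_rep_linear)
qed

text \<open>Meaningful on the invariants, and if \<^const>\<open>\<Phi>\<close> is a bijection onto \<^const>\<open>End_gl\<close>.\<close>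

definition \<Xi> :: "complex^'k \<Rightarrow> 'n::finite gl_current uea \<Rightarrow> 'k::finite group_algebra" where
  "\<Xi> p u = inv \<Phi> (\<phi>\<^sub>o p u)"

text \<open>For \<open>\<tau> = (r, s)\<close> this is \<open>P\<^sub>\<tau>\<close> at \<open>r\<close> and \<open>Q\<^sub>\<tau>\<close> at \<open>s\<close>.\<close>

definition site_poly :: "complex^'k \<Rightarrow> 'k::finite \<Rightarrow> complex poly" where
  "site_poly p r = [:1 - p $ r, 1:] * (\<Prod>d\<in>UNIV - {r}. smult (1 / (p $ r - p $ d)) [:- p $ d, 1:])"

end

theory Submission
  imports Defs
begin

text \<open>
  The polynomial \<^term>\<open>site_poly p r\<close> is \<open>1\<close> at \<open>p\<^sub>r\<close> and \<open>0\<close> at every other \<open>p\<^sub>d\<close>, so \<open>x(P\<^sub>\<tau>)\<close> acts on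
  the evaluation module as \<open>x\<close> on the single factor \<open>r\<close>, and \<open>x(Q\<^sub>\<tau>)\<close> as \<open>x\<close> on the factor \<open>s\<close>. Hence
  the double sum acts as the Casimir tensor \<open>\<Sum> E\<^sub>i\<^sub>j \<otimes> E\<^sub>j\<^sub>i\<close> on the factors \<open>r\<close> and \<open>s\<close>, which is the flip.
  Invariance holds for arbitrary polynomials because the Casimir tensor is itself invariant.
\<close>

lemma \<iota>_sum:
  fixes x :: "'i \<Rightarrow> 'a::complex_lie_algebra"
  shows "\<iota> (\<Sum>i\<in>I. x i) = (\<Sum>i\<in>I. \<iota> (x i))"
proof -
  have "\<iota> (0 :: 'a) = 0" using \<iota>_add[of "0 :: 'a" 0] by simp
  then show ?thesis
    by (induction I rule: infinite_finite_induct) (simp_all add: \<iota>_add)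
qed

lemma \<iota>_diff: "\<iota> (x - y) = \<iota> x - \<iota> y"
  using \<iota>_add[of "x - y" y] by simp

text \<open>Scalars are central modulo the ideal. As \<open>uea\<close> is equipped only as a ring,
  this is how coefficients get moved between the two factors.\<close>

lemma \<iota>_scale_mult_swap: "\<iota> (lie_scale c x) * \<iota> y = \<iota> x * \<iota> (lie_scale c y)"
proof transfer
  fix c and x y :: 'a
  let ?c = "Poly_Mapping.single 0 c :: 'a free_algebra"
  have "?c * gen x = gen x * ?c"
    by (simp add: gen_def mult_single)
  \<comment> \<open>A combination of two scaling relations; the terms containing \<open>?c\<close>
    cancel by centrality.\<close>
  then have "gen (lie_scale c x) * gen y - gen x * gen (lie_scale c y)
      = (gen (lie_scale c x) - ?c * gen x) * gen y + - (gen x * (gen (lie_scale c y) - ?c * gen y))"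
    by (simp add: left_diff_distrib right_diff_distrib flip: mult.assoc)
  also have "\<dots> \<in> uea_ideal"
    by (intro uea_ideal.add uea_ideal_uminus uea_ideal_mult_left uea_ideal_mult_right
        uea_ideal.rel_scale)
  finally show "gen (lie_scale c x) * gen y - gen x * gen (lie_scale c y) \<in> uea_ideal" .
qed

lemma uea_ad_mult: "uea_ad x (u * v) = uea_ad x u * v + u * uea_ad x v"
  by (simp add: uea_ad_def algebra_simps)

lemma uea_ad_sum: "uea_ad x (\<Sum>i\<in>I. u i) = (\<Sum>i\<in>I. uea_ad x (u i))"
  by (simp add: uea_ad_def sum_distrib_left sum_distrib_right sum_subtractf)

lemma tensor_poly_diff: "(x - y) \<otimes>\<^sub>t P = x \<otimes>\<^sub>t P - y \<otimes>\<^sub>t P"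
  by transfer (simp add: vec_eq_iff smult_diff_left)

lemma uea_ad_\<iota>: "uea_ad x (\<iota> (y \<otimes>\<^sub>t P)) = \<iota> ((x ** y) \<otimes>\<^sub>t P) - \<iota> ((y ** x) \<otimes>\<^sub>t P)"
  by (simp add: uea_ad_def bracket_tensor_poly tensor_poly_diff \<iota>_diff flip: \<iota>_bracket)

text \<open>Expands the products coming from the adjoint action in matrix units, with coefficients
  as \<open>lie_scale\<close> so that \<open>\<iota>_scale_mult_swap\<close> can collect
  them.\<close>

lemma matrix_unit_mult_left:
  "(x ** matrix_unit i j) \<otimes>\<^sub>t P = (\<Sum>a\<in>UNIV. lie_scale (x $ a $ i) (matrix_unit a j \<otimes>\<^sub>t P))"
proof -
  have "smult (\<Sum>b\<in>UNIV. x $ k $ b * (if b = i \<and> l = j then 1 else 0)) P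
      = (\<Sum>a\<in>UNIV. smult (x $ a $ i * (if k = a \<and> l = j then 1 else 0)) P)" for k l
    by (cases "l = j") (simp_all add: if_distrib if_distribR cong: if_cong)
  then show ?thesis
    by (simp add: entries_inject [symmetric] vec_eq_iff entries_sum tensor_poly.rep_eq
        lie_scale_gl_current.rep_eq matrix_unit_def matrix_matrix_mult_def)
qed

lemma matrix_unit_mult_right:
  "(matrix_unit i j ** x) \<otimes>\<^sub>t P = (\<Sum>a\<in>UNIV. lie_scale (x $ j $ a) (matrix_unit i a \<otimes>\<^sub>t P))"
proof -
  have "smult (\<Sum>b\<in>UNIV. (if k = i \<and> b = j then 1 else 0) * x $ b $ l) P
      = (\<Sum>a\<in>UNIV. smult (x $ j $ a * (if k = i \<and> l = a then 1 else 0)) P)" for k l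
    by (cases "k = i") (simp_all add: if_distrib if_distribR cong: if_cong)
  then show ?thesis
    by (simp add: entries_inject [symmetric] vec_eq_iff entries_sum tensor_poly.rep_eq
        lie_scale_gl_current.rep_eq matrix_unit_def matrix_matrix_mult_def)
qed

lemma casimir_in_invariants:
  "(\<Sum>i\<in>UNIV. \<Sum>j\<in>UNIV. \<iota> (matrix_unit i j \<otimes>\<^sub>t P) * \<iota> (matrix_unit j i \<otimes>\<^sub>t Q))
    \<in> (uea_invariants :: 'n::finite gl_current uea set)"
proof -
  have "uea_ad x (\<Sum>i\<in>UNIV. \<Sum>j\<in>UNIV. \<iota> (matrix_unit i j \<otimes>\<^sub>t P) * \<iota> (matrix_unit j i \<otimes>\<^sub>t Q)) = 0"
    for x :: "complex^'n^'n"
  proof -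
    \<comment> \<open>A normal form with every scalar on the second factor: terms that agree
      mathematically then differ only in index names.\<close>
    define K where "K c i j k l = \<iota> (matrix_unit i j \<otimes>\<^sub>t P) * \<iota> (lie_scale c (matrix_unit k l \<otimes>\<^sub>t Q))"
      for c and i j k l :: 'n
    have "uea_ad x (\<Sum>i\<in>UNIV. \<Sum>j\<in>UNIV. \<iota> (matrix_unit i j \<otimes>\<^sub>t P) * \<iota> (matrix_unit j i \<otimes>\<^sub>t Q))
      = (\<Sum>i\<in>UNIV. \<Sum>j\<in>UNIV. \<Sum>a\<in>UNIV. K (x $ a $ i) a j j i)
      - (\<Sum>i\<in>UNIV. \<Sum>j\<in>UNIV. \<Sum>a\<in>UNIV. K (x $ j $ a) i a j i)
      + ((\<Sum>i\<in>UNIV. \<Sum>j\<in>UNIV. \<Sum>a\<in>UNIV. K (x $ a $ j) i j a i)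
      - (\<Sum>i\<in>UNIV. \<Sum>j\<in>UNIV. \<Sum>a\<in>UNIV. K (x $ i $ a) i j j a))"
      by (simp add: uea_ad_sum uea_ad_mult uea_ad_\<iota> matrix_unit_mult_left matrix_unit_mult_right
          \<iota>_sum left_diff_distrib right_diff_distrib sum_distrib_left sum_distrib_right
          \<iota>_scale_mult_swap sum.distrib sum_subtractf K_def)
    \<comment> \<open>The four sums come from the Leibniz rule and cancel in pairs. Here right
      multiplication on the first factor meets left multiplication on the second, with
      \<open>j\<close> and \<open>a\<close> exchanged.\<close>
    also have "(\<Sum>i\<in>UNIV. \<Sum>j\<in>UNIV. \<Sum>a\<in>UNIV. K (x $ j $ a) i a j i)
        = (\<Sum>i\<in>UNIV. \<Sum>j\<in>UNIV. \<Sum>a\<in>UNIV. K (x $ a $ j) i j a i)"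
      by (intro sum.cong refl sum.swap)
    \<comment> \<open>The other pair matches after exchanging \<open>i\<close> and \<open>a\<close>,
      the outermost and innermost indices, hence the repeated swaps.\<close>
    also have "(\<Sum>i\<in>UNIV. \<Sum>j\<in>UNIV. \<Sum>a\<in>UNIV. K (x $ i $ a) i j j a)
        = (\<Sum>j\<in>UNIV. \<Sum>a\<in>UNIV. \<Sum>i\<in>UNIV. K (x $ i $ a) i j j a)"
      by (subst sum.swap) (intro sum.cong refl sum.swap)
    also have "\<dots> = (\<Sum>i\<in>UNIV. \<Sum>j\<in>UNIV. \<Sum>a\<in>UNIV. K (x $ a $ i) a j j i)"
      by (rule sum.swap)
    finally show ?thesis by simp
  qed
  then show ?thesis by (simp add: uea_invariants_def)
qed


text \<open>The product is the Lagrange basis polynomial at \<open>p $ r\<close>: for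
  \<open>q \<noteq> r\<close> its factor \<open>d = q\<close> vanishes. The remaining linear factor
  is 1 at \<open>p $ r\<close>.\<close>

lemma poly_site_poly:
  assumes "inj (($) p)"
  shows "poly (site_poly p r) (p $ q) = (if q = r then 1 else 0)"
proof -
  have ne: "p $ r - p $ d \<noteq> 0" if "d \<noteq> r" for d
    using that injD[OF assms, of r d] by auto
  have "(\<Prod>d\<in>UNIV - {r}. 1 / (p $ r - p $ d) * (p $ q - p $ d)) = (if q = r then 1 else 0)"
  proof (cases "q = r")
    case True
    then show ?thesis using ne by (auto intro!: prod.neutral)
  next
    case False
    then show ?thesis by (auto intro!: prod_zero)
  qed
  then show ?thesis
    by (simp add: site_poly_def poly_prod left_diff_distrib right_diff_distrib
        flip: diff_divide_distrib)
qed

lemma current_act_site_poly: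
  fixes T :: "('n::finite, 'k::finite) tensor_power"
  assumes "inj (($) p)"
  shows "current_act p (x \<otimes>\<^sub>t site_poly p r) T = site_act r x T"
proof -
  have "site_act q (eval_at (x \<otimes>\<^sub>t site_poly p r) (p $ q)) T
      = (if q = r then site_act r x T else 0)" for q
    by (simp add: eval_at_def tensor_poly.rep_eq poly_site_poly[OF assms] site_act_def vec_eq_iff)
  then show ?thesis by (simp add: current_act_def)
qed

lemma site_act_matrix_unit:
  "site_act q (matrix_unit i j) T $ f = (if f q = i then T $ f(q := j) else 0)"
  by (simp add: site_act_def matrix_unit_def if_distrib if_distribR cong: if_cong)

lemma casimir_eq_swap:
  assumes "r \<noteq> s"
  shows "(\<Sum>i\<in>UNIV. \<Sum>j\<in>UNIV. site_act r (matrix_unit i j) (site_act s (matrix_unit j i) T))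
    = perm_act (Perm.swap r s) T"
proof -
  have "(\<Sum>i\<in>UNIV. \<Sum>j\<in>UNIV. site_act r (matrix_unit i j) (site_act s (matrix_unit j i) T) $ f)
      = T $ f(r := f s, s := f r)" for f
  proof -
    \<comment> \<open>In coordinate \<open>f\<close> only \<open>i = f r\<close>,
      \<open>j = f s\<close> survives. Since \<open>r \<noteq> s\<close>, the update at
      \<open>r\<close> leaves the entry at \<open>s\<close> intact.\<close>
    have "(\<Sum>i\<in>UNIV. \<Sum>j\<in>UNIV. site_act r (matrix_unit i j) (site_act s (matrix_unit j i) T) $ f)
        = (\<Sum>i\<in>UNIV. \<Sum>j\<in>UNIV. if f s = j then if f r = i then T $ f(r := j, s := i) else 0 else 0)"
      using assms by (intro sum.cong) (auto simp: site_act_matrix_unit)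
    then show ?thesis by simp
  qed
  moreover have "f(r := f s, s := f r) = f \<circ> perm.apply (Perm.swap r s)" for f :: "'a \<Rightarrow> 'b"
    using assms by (auto simp: fun_eq_iff Perm.swap.rep_eq transpose_def)
  ultimately show ?thesis by (simp add: vec_eq_iff perm_act_def)
qed

lemma eval_rep_sum: "eval_rep p (\<Sum>i\<in>I. u i) T = (\<Sum>i\<in>I. eval_rep p (u i) T)"
proof -
  have "eval_rep p 0 T = 0" using eval_rep_minus[of p 0 0 T] by simp
  then show ?thesis
    by (induction I rule: infinite_finite_induct) (simp_all add: eval_rep_add)
qed

text \<open>Invariance is part of the conclusion because \<open>\<phi>\<^sub>o\<close> is a
  \<open>restrict\<close>, hence \<open>undefined\<close> off the invariants.\<close>

theorem proposition14:
  fixes p :: "complex^'k::finite" and r s :: 'k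
  assumes "inj (($) p)"
    and "bij_betw (\<Phi> :: 'k group_algebra \<Rightarrow> ('n::finite, 'k) tensor_power \<Rightarrow> ('n, 'k) tensor_power)
      UNIV End_gl"
    and "r \<noteq> s"
  shows "let u = (\<Sum>i\<in>UNIV. \<Sum>j\<in>UNIV.
        \<iota> (matrix_unit i j \<otimes>\<^sub>t site_poly p r) * \<iota> (matrix_unit j i \<otimes>\<^sub>t site_poly p s))
          :: 'n gl_current uea
    in u \<in> uea_invariants \<and> \<Xi> p u = group_elem (Perm.swap r s)"
proof -
  let ?\<Phi> = "\<Phi> :: 'k group_algebra \<Rightarrow> ('n, 'k) tensor_power \<Rightarrow> ('n, 'k) tensor_power"
  define u :: "'n gl_current uea" where "u = (\<Sum>i\<in>UNIV. \<Sum>j\<in>UNIV.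
    \<iota> (matrix_unit i j \<otimes>\<^sub>t site_poly p r) * \<iota> (matrix_unit j i \<otimes>\<^sub>t site_poly p s))"
  have inv: "u \<in> uea_invariants"
    unfolding u_def by (rule casimir_in_invariants)
  have "\<phi>\<^sub>o p u = ?\<Phi> (group_elem (Perm.swap r s))"
  proof
    fix T :: "('n, 'k) tensor_power"
    have "\<phi>\<^sub>o p u T
        = (\<Sum>i\<in>UNIV. \<Sum>j\<in>UNIV. site_act r (matrix_unit i j) (site_act s (matrix_unit j i) T))"
      using inv by (simp add: \<phi>\<^sub>o_def u_def eval_rep_sum eval_rep_mult eval_rep_\<iota>
          current_act_site_poly[OF assms(1)])
    then show "\<phi>\<^sub>o p u T = ?\<Phi> (group_elem (Perm.swap r s)) T"
      by (simp add: casimir_eq_swap[OF assms(3)] \<Phi>_group_elem)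
  qed
  \<comment> \<open>Injectivity makes \<open>inv \<Phi>\<close> in \<open>\<Xi>\<close> return the
    preimage just found.\<close>
  moreover have "inj ?\<Phi>"
    using assms(2) by (rule bij_betw_imp_inj_on)
  ultimately have "\<Xi> p u = group_elem (Perm.swap r s)"
    by (simp add: \<Xi>_def)
  with inv show ?thesis by (simp add: u_def)
qed

end
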